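(* Let $k>s$ be positive integers, for $n\ge1$ let $b_n^{(k,s)}$ be the number of vertices of the polytope $P_{n,k,s}$, and let $\lambda_1$ be the largest positive eigenvalue of the matrix $A_{k,s}$. Then $$\lim_{n\to\infty}\frac1n\ln b_n^{(k,s)}=\ln\lambda_1.$$
   Context: For positive integers $n,k,s$ let $K=s(n-1)+k$ and let $e_0,\ldots,e_{K-1}$ be the standard basis of $\mathbb{R}^{K}$. For $0\le i\le n-1$ put $\{si,si+1,\ldots,si+k-1\}=:W_i$ and $\Delta_{W_i}=\operatorname{conv}\{e_j: j\in W_i\}$. Then $P_{n,k,s}=\sum_{i=0}^{n-1}\Delta_{W_i}$ (Minkowski sum). For $k>s$, $D_{k,s}$ is the digraph with vertex set $\{0,\ldots,k-1\}$ containing all possible arcs (including loops) except the arcs $(s+i',j')$ with $i',j'\in\{0,\ldots,k-1-s\}$ and $i'\neq j'$. Its adjacency matrix $A_{k,s}=(a_{ij})_{i,j=1}^k$ has $a_{ij}=1$ if $(i-1,j-1)$ is an arc and $a_{ij}=0$ otherwise. *)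

theory Defs
  imports
    "HOL-Analysis.Analysis"
    "HOL-Library.Function_Algebras"
    "HOL-Library.Set_Algebras"
    "Graph_Theory.Pair_Digraph"
    "Jordan_Normal_Form.Char_Poly"
begin

text \<open>
  The ambient space \<open>\<real>\<^sup>K\<close>, \<open>K = s(n-1) + k\<close>, varies with \<open>n\<close>, so it is realised as the space of
  functions \<open>nat \<Rightarrow> real\<close> vanishing outside \<open>{..<K}\<close>, a linear subspace of \<open>nat \<Rightarrow> real\<close>. Convex hulls,
  Minkowski sums and extreme points do not depend on the surrounding space. The library provides
  pointwise addition of functions, but not the real vector space structure.
\<close>

instantiation "fun" :: (type, real_vector) real_vector
begin

definition scaleR_fun :: "real \<Rightarrow> ('a \<Rightarrow> 'b) \<Rightarrow> 'a \<Rightarrow> 'b" where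
  "scaleR_fun c f = (\<lambda>x. c *\<^sub>R f x)"

instance
  by standard (simp_all add: scaleR_fun_def plus_fun_def fun_eq_iff scaleR_add_right scaleR_add_left)

end

definition std_basis :: "nat \<Rightarrow> nat \<Rightarrow> real" where
  "std_basis j = (\<lambda>i. if i = j then 1 else 0)"

definition window :: "nat \<Rightarrow> nat \<Rightarrow> nat \<Rightarrow> nat set" where
  "window k s i = {s * i ..< s * i + k}"

definition coord_simplex :: "nat set \<Rightarrow> (nat \<Rightarrow> real) set" where
  "coord_simplex W = convex hull (std_basis ` W)"

text \<open>The sum is the Minkowski sum of sets, from \<^theory>\<open>HOL-Library.Set_Algebras\<close>.\<close>

definition P :: "nat \<Rightarrow> nat \<Rightarrow> nat \<Rightarrow> (nat \<Rightarrow> real) set" where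
  "P n k s = (\<Sum>i<n. coord_simplex (window k s i))"

lemma P_ambient:
  assumes "x \<in> P n k s" and "j \<ge> s * (n - 1) + k"
  shows "x j = 0"
proof -
  have simplex: "y j = 0" if "y \<in> coord_simplex W" "j \<notin> W" for y W
  proof -
    have "convex {y :: nat \<Rightarrow> real. y j = 0}"
      by (auto simp: convex_def scaleR_fun_def)
    moreover have "std_basis ` W \<subseteq> {y. y j = 0}"
      using that(2) by (auto simp: std_basis_def)
    ultimately have "coord_simplex W \<subseteq> {y. y j = 0}"
      unfolding coord_simplex_def by (rule hull_minimal[rotated])
    then show ?thesis using that(1) by auto
  qed
  obtain y where x: "x = sum y {..<n}" and y: "\<And>i. i < n \<Longrightarrow> y i \<in> coord_simplex (window k s i)"
    using assms(1) by (auto simp: P_def set_sum_alt)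
  have "y i j = 0" if "i < n" for i
  proof -
    have "s * i \<le> s * (n - 1)"
      using that by (intro mult_le_mono2) simp
    then have "s * i + k \<le> j"
      using assms(2) by linarith
    then have "j \<notin> window k s i"
      by (simp add: window_def)
    then show ?thesis using simplex y that by blast
  qed
  moreover have "sum y A j = (\<Sum>i\<in>A. y i j)" for A
    by (induction A rule: infinite_finite_induct) auto
  ultimately show ?thesis using x by simp
qed

definition vertex_count :: "nat \<Rightarrow> nat \<Rightarrow> nat \<Rightarrow> nat" where
  "vertex_count k s n = card {v. v extreme_point_of P n k s}"

definition D :: "nat \<Rightarrow> nat \<Rightarrow> nat pair_pre_digraph" where
  "D k s =
    \<lparr> pverts = {0..<k},
      parcs = {0..<k} \<times> {0..<k}
        - {(s + i, j) | i j. i \<in> {0..k - 1 - s} \<and> j \<in> {0..k - 1 - s} \<and> i \<noteq> j} \<rparr>"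

text \<open>Matrices are indexed from 0, so the entry at \<open>(i, j)\<close> refers to the arc \<open>(i, j)\<close> itself.\<close>

definition A :: "nat \<Rightarrow> nat \<Rightarrow> real mat" where
  "A k s = mat k k (\<lambda>(i, j). if (i, j) \<in> parcs (D k s) then 1 else 0)"

text \<open>
  \<^const>\<open>Max\<close> is meaningful only on finite nonempty sets. The set below is finite, since eigenvalues
  are roots of the characteristic polynomial, and for \<open>0 < s < k\<close> it is nonempty by the
  Perron-Frobenius theorem.
\<close>

definition lambda1 :: "nat \<Rightarrow> nat \<Rightarrow> real" where
  "lambda1 k s = Max {x. eigenvalue (A k s) x \<and> 0 < x}"

end

theory Submission
  imports Defs
begin

text \<open>
  A vertex of a Minkowski sum decomposes uniquely into vertices of the summands, so a vertex of
  \<open>P\<close> amounts to a choice of one position \<open>p i < k\<close> in each window. Neighbouring windows sharing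
  two chosen coordinates would allow an exchange, which exhibits the point as a midpoint; this
  forces \<open>(p i, p (i + 1))\<close> to be an arc of the digraph. Conversely, a height function whose maximum
  on each window is attained exactly at the chosen position is built window by window along any
  walk. So \<open>P\<close> has as many vertices as there are walks with \<open>n\<close> nodes.

  The adjacency matrix has an explicit positive eigenvector, depending only on \<open>p div s\<close>; its
  eigenvalue is found by the intermediate value theorem. Comparison with a positive eigenvector
  shows that this eigenvalue is the largest positive one and that the number of walks lies between
  constant multiples of its powers.
\<close>

section \<open>Extreme points of Minkowski sums\<close>

lemma extreme_point_of_symmetric:
  fixes x d :: "'a::real_vector"
  assumes "x extreme_point_of S" "x - d \<in> S" "x + d \<in> S"
  shows "d = 0"
proof (rule ccontr)
  assume "d \<noteq> 0"
  have eq: "(1 - 1/2) *\<^sub>R (x - d) + (1/2) *\<^sub>R (x + d) = x"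
    by (simp add: algebra_simps flip: scaleR_add_left)
  have "x - d \<noteq> x + d"
  proof
    assume "x - d = x + d"
    then have "2 *\<^sub>R d = 0" by (simp add: scaleR_2 algebra_simps)
    then show False using \<open>d \<noteq> 0\<close> by simp
  qed
  then have "x \<in> open_segment (x - d) (x + d)"
    unfolding in_segment using eq by (intro conjI exI[of _ "1/2"]) auto
  then show False using assms by (auto simp: extreme_point_of_def)
qed

text \<open>With the other summands frozen, translation by their sum \<open>r\<close> carries a
  segment of \<open>S i\<close> through \<open>y i\<close> to a segment of the Minkowski sum through
  \<open>sum y I\<close>.\<close>

lemma extreme_point_of_sumD:
  fixes y :: "'i \<Rightarrow> 'a::real_vector"
  assumes ext: "sum y I extreme_point_of sum S I" and fin: "finite I"
    and y: "\<And>i. i \<in> I \<Longrightarrow> y i \<in> S i" and i: "i \<in> I"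
  shows "y i extreme_point_of S i"
  unfolding extreme_point_of_def
proof (intro conjI ballI notI)
  show "y i \<in> S i" using y i .
  fix a b assume ab: "a \<in> S i" "b \<in> S i" "y i \<in> open_segment a b"
  define r where "r = sum y (I - {i})"
  have upd: "sum (y(i := c)) I = c + r" for c
    unfolding r_def using fin i by (subst sum.remove[of _ i]) auto
  have mem: "c + r \<in> sum S I" if "c \<in> S i" for c
    unfolding set_sum_alt[OF fin] using that y
    by (intro CollectI exI[of _ "y(i := c)"] conjI) (simp only: upd, simp)
  have x: "sum y I = y i + r"
    using upd[of "y i"] by simp
  obtain u where u: "0 < u" "u < 1" "y i = (1 - u) *\<^sub>R a + u *\<^sub>R b" "a \<noteq> b"
    using ab(3) by (auto simp: in_segment)
  have "sum y I = (1 - u) *\<^sub>R (a + r) + u *\<^sub>R (b + r)"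
    unfolding x u(3) by (simp add: algebra_simps)
  then have "sum y I \<in> open_segment (a + r) (b + r)"
    unfolding in_segment using u by auto
  then show False using ext mem ab by (auto simp: extreme_point_of_def)
qed

text \<open>Adding \<open>a\<close> to the points with \<open>L y < L a\<close> gives a convex set,
  which contains the hull as soon as it contains \<open>S\<close>.\<close>

lemma convex_hull_strict_maximizer:
  fixes L :: "'a::real_vector \<Rightarrow> real"
  assumes L: "linear L" and max: "\<And>x. x \<in> S \<Longrightarrow> x \<noteq> a \<Longrightarrow> L x < L a"
    and y: "y \<in> convex hull S" "y \<noteq> a"
  shows "L y < L a"
proof -
  interpret linear L by fact
  let ?T = "{y. y = a \<or> L y < L a}"
  have "convex ?T"
    unfolding convex_def
  proof (intro ballI allI impI)
    fix x y and u v :: real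
    assume xy: "x \<in> ?T" "y \<in> ?T" and uv: "0 \<le> u" "0 \<le> v" "u + v = 1"
    consider "u = 0" | "v = 0" | "x = a" "y = a" | "u > 0" "v > 0" "L x < L a \<or> L y < L a"
      using xy uv by fastforce
    then show "u *\<^sub>R x + v *\<^sub>R y \<in> ?T"
    proof cases
      case 4
      have le: "L x \<le> L a" "L y \<le> L a" using xy by auto
      have "u * L x + v * L y < u * L a + v * L a"
        using 4 le by (smt (verit) mult_left_mono mult_strict_left_mono)
      also have "\<dots> = L a" using uv by (simp flip: distrib_right)
      finally show ?thesis by (simp add: add scale)
    qed (use xy uv in \<open>auto simp flip: scaleR_add_left\<close>)
  qed
  then have "convex hull S \<subseteq> ?T"
    using max by (intro hull_minimal) auto
  then show ?thesis using y by auto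
qed

text \<open>\<open>L\<close> is additive, so one summand away from its maximiser makes the total
  strictly smaller.\<close>

lemma sum_maximizer_unique:
  fixes L :: "'a::real_vector \<Rightarrow> real"
  assumes L: "linear L" and fin: "finite I"
    and max: "\<And>i x. i \<in> I \<Longrightarrow> x \<in> S i \<Longrightarrow> x \<noteq> a i \<Longrightarrow> L x < L (a i)"
    and y: "\<And>i. i \<in> I \<Longrightarrow> y i \<in> S i" and ge: "L (sum a I) \<le> L (sum y I)" and i: "i \<in> I"
  shows "y i = a i"
proof (rule ccontr)
  assume ne: "y i \<noteq> a i"
  have "(\<Sum>i\<in>I. L (y i)) < (\<Sum>i\<in>I. L (a i))"
  proof (rule sum_strict_mono_ex1[OF fin])
    show "\<forall>i\<in>I. L (y i) \<le> L (a i)" using max y by (metis less_eq_real_def)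
    show "\<exists>i\<in>I. L (y i) < L (a i)" using max y i ne by blast
  qed
  then show False using ge by (simp add: linear_sum[OF L])
qed

lemma extreme_point_of_if_maximizer:
  fixes L :: "'a::real_vector \<Rightarrow> real"
  assumes L: "linear L" and x: "x \<in> S" and max: "\<And>y. y \<in> S \<Longrightarrow> y \<noteq> x \<Longrightarrow> L y < L x"
  shows "x extreme_point_of S"
  unfolding extreme_point_of_def
proof (intro conjI ballI notI x)
  interpret linear L by fact
  fix a b assume ab: "a \<in> S" "b \<in> S" "x \<in> open_segment a b"
  obtain u where u: "0 < u" "u < 1" "x = (1 - u) *\<^sub>R a + u *\<^sub>R b"
    using ab(3) by (auto simp: in_segment)
  have ne: "a \<noteq> x" "b \<noteq> x" using ab(3) by (auto simp: open_segment_def)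
  have "L x = (1 - u) * L a + u * L b" by (subst u(3)) (simp add: add scale)
  also have "\<dots> < (1 - u) * L x + u * L x"
    using u max[OF ab(1) ne(1)] max[OF ab(2) ne(2)]
    by (intro add_strict_mono mult_strict_left_mono) simp_all
  finally show False by (simp add: algebra_simps)
qed

section \<open>Vertices and walks\<close>

text \<open>One node per window: the entry at index \<open>i\<close> is an offset inside window
  \<open>i\<close>, so \<open>n\<close> counts nodes, not arcs.\<close>

definition walks :: "nat \<Rightarrow> nat \<Rightarrow> nat \<Rightarrow> nat list set" where
  "walks k s n =
    {xs. length xs = n \<and> set xs \<subseteq> {..<k} \<and> successively (\<lambda>p q. (p, q) \<in> parcs (D k s)) xs}"

definition walk_point :: "nat \<Rightarrow> nat list \<Rightarrow> nat \<Rightarrow> real" where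
  "walk_point s xs = (\<Sum>i<length xs. std_basis (s * i + xs ! i))"

text \<open>The two inner premises say that the coordinates at offsets \<open>p\<close> and
  \<open>q\<close> of consecutive windows both lie in both windows; an arc then requires them to be
  the same coordinate.\<close>

lemma arc_iff:
  assumes "s < k"
  shows "(p, q) \<in> parcs (D k s) \<longleftrightarrow> p < k \<and> q < k \<and> (s \<le> p \<longrightarrow> q < k - s \<longrightarrow> p = s + q)"
proof -
  have "(\<exists>i j. p = s + i \<and> q = j \<and> i \<le> k - 1 - s \<and> j \<le> k - 1 - s \<and> i \<noteq> j) \<longleftrightarrow>
      s \<le> p \<and> q < k - s \<and> p \<noteq> s + q" if "p < k" "q < k"
    using that assms by (auto intro!: exI[of _ "p - s"])
  then show ?thesis by (auto simp: D_def)
qed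

lemma in_window_iff: "m \<in> window k s i \<longleftrightarrow> s * i \<le> m \<and> m < s * i + k"
  by (simp add: window_def)

lemma std_basis_inj [simp]: "std_basis i = std_basis j \<longleftrightarrow> i = j"
  by (auto simp: std_basis_def fun_eq_iff split: if_splits)

lemma less_window_end:
  assumes "l \<le> i" "x \<in> window k s l"
  shows "x < s * i + k"
proof -
  have "s * l \<le> s * i" using assms by simp
  moreover have "x < s * l + k" using assms by (simp add: in_window_iff)
  ultimately show ?thesis by linarith
qed

section \<open>Heights with a prescribed strict maximum on each window\<close>

lemma strictly_above_finite:
  fixes S :: "real set"
  assumes "finite S" "\<And>x. x \<in> S \<Longrightarrow> x < b"
  shows "\<exists>t<b. \<forall>x\<in>S. x < t"
proof (cases "S = {}")
  case True
  then show ?thesis by (auto intro: lt_ex)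
next
  case False
  then have "Max S < b" using assms by auto
  then obtain t where "Max S < t" "t < b" using dense by blast
  then show ?thesis using assms(1) by (meson Max_ge order.strict_trans1)
qed

text \<open>Induction on the number of windows. Coordinates beyond all earlier windows have free
  heights; the difficulty is a new chosen coordinate that already has a height.\<close>

lemma exists_height:
  fixes p :: "nat \<Rightarrow> nat"
  assumes sk: "s < k" and p: "\<And>i. i < n \<Longrightarrow> p i < k"
    and arc: "\<And>i. Suc i < n \<Longrightarrow> (p i, p (Suc i)) \<in> parcs (D k s)"
  shows "\<exists>c::nat \<Rightarrow> real. \<forall>i<n. \<forall>x\<in>window k s i. x \<noteq> s * i + p i \<longrightarrow> c x < c (s * i + p i)"
  using p arc
proof (induction n)
  case 0
  then show ?case by simp
next
  case (Suc n)
  show ?case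
  proof (cases n)
    case 0
    show ?thesis
      by (rule exI[of _ "\<lambda>x. if x = p 0 then 1 else 0"]) (simp add: 0)
  next
    case [simp]: (Suc i)
    have "\<exists>c::nat \<Rightarrow> real. \<forall>l<n. \<forall>x\<in>window k s l. x \<noteq> s * l + p l \<longrightarrow> c x < c (s * l + p l)"
      using Suc.prems by (intro Suc.IH) auto
    then obtain c :: "nat \<Rightarrow> real" where
      c: "\<And>l x. l \<le> i \<Longrightarrow> x \<in> window k s l \<Longrightarrow> x \<noteq> s * l + p l \<Longrightarrow> c x < c (s * l + p l)"
      by (metis Suc less_Suc_eq_le)
    define a m K where "a = s * i + p i" and "m = s * Suc i + p (Suc i)" and "K = s * i + k"
    have pi: "p i < k" "p (Suc i) < k" and arc: "(p i, p (Suc i)) \<in> parcs (D k s)"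
      using Suc.prems by auto
    have a_win: "a \<in> window k s i" using pi by (simp add: a_def in_window_iff)
    have old: "x < K" if "l \<le> i" "x \<in> window k s l" for l x
      using less_window_end[OF that] by (simp add: K_def)
    have chosen: "s * l + p l \<in> window k s l" if "l \<le> i" for l
      using that Suc.prems(1)[of l] by (simp add: in_window_iff)
    have extend: ?thesis if
      c': "\<And>l x. l \<le> i \<Longrightarrow> x \<in> window k s l \<Longrightarrow> x \<noteq> s * l + p l \<Longrightarrow> c' x < c' (s * l + p l)"
        "\<And>x. x \<in> window k s (Suc i) \<Longrightarrow> x \<noteq> m \<Longrightarrow> c' x < c' m" for c' :: "nat \<Rightarrow> real"
      using c' by (intro exI[of _ c']) (auto simp: less_Suc_eq_le le_Suc_eq m_def)
    \<comment> \<open>\<open>K\<close> is the end of the earlier windows. Either \<open>m\<close> is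
      fresh, or it lies in window \<open>i\<close> as well; then the split is on whether
      \<open>a\<close> still belongs to the new window.\<close>
    consider (new) "K \<le> m" | (stay) "m < K" "s * Suc i \<le> a" | (leave) "m < K" "a < s * Suc i"
      by linarith
    then show ?thesis
    proof cases
      case new
      \<comment> \<open>No earlier window contains \<open>m\<close>, so it may rise above every old
        height.\<close>
      obtain M where M: "\<And>x. x < K \<Longrightarrow> c x < M"
      proof
        fix x assume "x < K"
        then have "c x \<le> Max (c ` {..<K})" by simp
        then show "c x < Max (c ` {..<K}) + 1" by linarith
      qed
      define c' where "c' x = (if x < K then c x else if x = m then M else M - 1)" for x
      show ?thesis
      proof (rule extend[of c'])
        show "c' x < c' (s * l + p l)"
          if "l \<le> i" "x \<in> window k s l" "x \<noteq> s * l + p l" for l x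
          using c[OF that] old that chosen by (simp add: c'_def)
        show "c' x < c' m" if "x \<noteq> m" for x
          using that new M by (auto simp: c'_def)
      qed
    next
      case stay
      then have "p (Suc i) < k - s" "s \<le> p i"
        using sk by (auto simp: a_def m_def K_def)
      \<comment> \<open>Both \<open>a\<close> and \<open>m\<close> lie in both windows, so the arc
        forces them to coincide. The old heights stay, and fresh coordinates go below
        \<open>c a\<close>.\<close>
      then have [simp]: "m = a"
        using arc sk by (simp add: arc_iff a_def m_def)
      define L where "L = c a - 1"
      define c' where "c' x = (if x < K then c x else L)" for x
      show ?thesis
      proof (rule extend[of c'])
        show "c' x < c' (s * l + p l)"
          if "l \<le> i" "x \<in> window k s l" "x \<noteq> s * l + p l" for l x
          using c[OF that] old that chosen by (simp add: c'_def)
        show "c' x < c' m" if x: "x \<in> window k s (Suc i)" "x \<noteq> m" for x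
        proof (cases "x < K")
          case True
          then have "x \<in> window k s i" using x by (auto simp: in_window_iff K_def)
          then show ?thesis using c[of i x] True x stay by (simp add: c'_def a_def)
        next
          case False
          then show ?thesis using stay by (simp add: c'_def L_def)
        qed
      qed
    next
      case leave
      text \<open>Here the height of \<open>m\<close> has to be raised. This is harmless: a previous window containing
        \<open>m\<close> also contains \<open>a < m\<close>, so its maximum is at least \<open>c a\<close>.\<close>
      have "finite (c ` (window k s i - {a}))" by (simp add: window_def)
      moreover have "z < c a" if "z \<in> c ` (window k s i - {a})" for z
        using that c[of i] by (auto simp: a_def)
      ultimately obtain t where t: "t < c a" "\<And>z. z \<in> c ` (window k s i - {a}) \<Longrightarrow> z < t"
        using strictly_above_finite by meson
      have am: "a < m" using leave by (simp add: m_def)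
      have m_win: "m \<in> window k s i" using leave by (auto simp: in_window_iff m_def K_def)
      have a_in: "a \<in> window k s l" if "l \<le> i" "m \<in> window k s l" for l
      proof -
        have "s * l \<le> s * i" using that by simp
        then have "s * l \<le> a" unfolding a_def by linarith
        then show ?thesis using that am by (simp add: in_window_iff)
      qed
      have a_le: "c a \<le> c (s * l + p l)" if "l \<le> i" "m \<in> window k s l" for l
        using c[OF that(1) a_in[OF that]] by (cases "a = s * l + p l") auto
      have m_less: "c m < c a" using c[OF order_refl m_win] am by (simp add: a_def)
      \<comment> \<open>The height of \<open>m\<close> may change because \<open>m\<close> is not
        chosen in any earlier window: there it would have to reach \<open>c a\<close>.\<close>
      have ne: "s * l + p l \<noteq> m" if "l \<le> i" for l
        using a_le[OF that] chosen[OF that] m_less by fastforce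
      \<comment> \<open>Old coordinates of the new window lie in window \<open>i\<close> without
        \<open>a\<close>, hence below \<open>t\<close>, and fresh ones get \<open>t - 1\<close>. The
        bound \<open>t < c a\<close> protects the earlier maxima.\<close>
      define c' where "c' x = (if x = m then t else if x < K then c x else t - 1)" for x
      show ?thesis
      proof (rule extend[of c'])
        fix l x assume l: "l \<le> i" "x \<in> window k s l" "x \<noteq> s * l + p l"
        have "c' (s * l + p l) = c (s * l + p l)"
          using ne l old chosen by (simp add: c'_def)
        moreover have "c' x < c (s * l + p l)"
          using c[OF l] a_le[OF l(1)] l t(1) old by (cases "x = m") (auto simp: c'_def)
        ultimately show "c' x < c' (s * l + p l)" by simp
      next
        fix x assume x: "x \<in> window k s (Suc i)" "x \<noteq> m"
        show "c' x < c' m"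
        proof (cases "x < K")
          case True
          then have "x \<in> window k s i - {a}"
            using x leave by (auto simp: in_window_iff K_def)
          then show ?thesis using t(2) True x by (simp add: c'_def)
        next
          case False
          then show ?thesis using x by (simp add: c'_def)
        qed
      qed
    qed
  qed
qed

text \<open>The heights become the coefficients of \<open>L\<close>, and strict maximality on basis
  vectors passes to the simplex. Cutting the sum off at \<open>N\<close>, past all windows
  considered, keeps it finite.\<close>

lemma walk_functional:
  assumes sk: "s < k" and xs: "xs \<in> walks k s n"
  shows "\<exists>L :: (nat \<Rightarrow> real) \<Rightarrow> real. linear L \<and>
    (\<forall>i<n. \<forall>y\<in>coord_simplex (window k s i). y \<noteq> std_basis (s * i + xs ! i) \<longrightarrow>
      L y < L (std_basis (s * i + xs ! i)))"
proof -
  have "\<exists>c::nat \<Rightarrow> real. \<forall>i<n. \<forall>x\<in>window k s i. x \<noteq> s * i + xs ! i \<longrightarrow> c x < c (s * i + xs ! i)"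
    using xs by (intro exists_height[OF sk]) (auto simp: walks_def successively_conv_nth subset_iff)
  then obtain c :: "nat \<Rightarrow> real" where
    c: "\<And>i x. i < n \<Longrightarrow> x \<in> window k s i \<Longrightarrow> x \<noteq> s * i + xs ! i \<Longrightarrow> c x < c (s * i + xs ! i)"
    by blast
  define N where "N = s * n + k"
  define L where "L y = (\<Sum>j<N. c j * y j)" for y :: "nat \<Rightarrow> real"
  have L: "linear L"
    by (rule linearI)
      (simp_all add: L_def scaleR_fun_def sum.distrib distrib_left sum_distrib_left mult.left_commute)
  have basis: "L (std_basis x) = c x" if "i < n" "x \<in> window k s i" for i x
    using less_window_end[of i n x k s] that
    by (simp add: L_def std_basis_def N_def if_distrib [of "(*) _"] sum.delta cong: if_cong)
  show ?thesis
  proof (intro exI[of _ L] conjI allI impI ballI L)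
    fix i y assume i: "i < n" and y: "y \<in> coord_simplex (window k s i)" "y \<noteq> std_basis (s * i + xs ! i)"
    have "xs ! i < k" using xs i by (auto simp: walks_def subset_iff)
    then have "s * i + xs ! i \<in> window k s i" by (simp add: in_window_iff)
    then show "L y < L (std_basis (s * i + xs ! i))"
      using y i c by (intro convex_hull_strict_maximizer[OF L _ y[unfolded coord_simplex_def]])
        (auto simp: basis)
  qed
qed

section \<open>Correspondence between walks and vertices\<close>

lemma std_basis_in_coord_simplex: "m \<in> W \<Longrightarrow> std_basis m \<in> coord_simplex W"
  unfolding coord_simplex_def by (simp add: hull_inc)

lemma walk_nth_in_window: "xs \<in> walks k s n \<Longrightarrow> i < n \<Longrightarrow> s * i + xs ! i \<in> window k s i"
  by (auto simp: walks_def in_window_iff subset_iff)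

lemma mem_P_iff:
  "x \<in> P n k s \<longleftrightarrow> (\<exists>y. x = sum y {..<n} \<and> (\<forall>i<n. y i \<in> coord_simplex (window k s i)))"
  by (auto simp: P_def set_sum_alt)

text \<open>The functional of the walk has no other maximiser on \<open>P n k s\<close>: a point
  with at least the same value decomposes into the same basis vectors.\<close>

lemma walk_point_extreme:
  assumes sk: "s < k" and xs: "xs \<in> walks k s n"
  shows "walk_point s xs extreme_point_of P n k s"
proof -
  obtain L :: "(nat \<Rightarrow> real) \<Rightarrow> real" where L: "linear L" and max: "\<forall>i<n. \<forall>y\<in>coord_simplex (window k s i).
      y \<noteq> std_basis (s * i + xs ! i) \<longrightarrow> L y < L (std_basis (s * i + xs ! i))"
    using walk_functional[OF assms] by blast
  have len: "length xs = n" using xs by (simp add: walks_def)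
  show ?thesis
  proof (rule extreme_point_of_if_maximizer[OF L])
    show "walk_point s xs \<in> P n k s"
      unfolding mem_P_iff walk_point_def len
      using walk_nth_in_window[OF xs] std_basis_in_coord_simplex by blast
    fix z assume z: "z \<in> P n k s" "z \<noteq> walk_point s xs"
    then obtain y where y: "z = sum y {..<n}" "\<And>i. i < n \<Longrightarrow> y i \<in> coord_simplex (window k s i)"
      by (auto simp: mem_P_iff)
    show "L z < L (walk_point s xs)"
    proof (rule ccontr)
      assume "\<not> L z < L (walk_point s xs)"
      then have "L (\<Sum>i<n. std_basis (s * i + xs ! i)) \<le> L (sum y {..<n})"
        by (simp add: walk_point_def len y(1))
      then have "y i = std_basis (s * i + xs ! i)" if "i < n" for i
        using sum_maximizer_unique[OF L, of "{..<n}" "\<lambda>i. coord_simplex (window k s i)"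
          "\<lambda>i. std_basis (s * i + xs ! i)" y i] max y(2) that by simp
      then have "z = walk_point s xs"
        unfolding walk_point_def len y(1) by (intro sum.cong) auto
      then show False using z by simp
    qed
  qed
qed

text \<open>The functional of \<open>xs\<close> has the same value on the sum along
  \<open>ys\<close>, so by uniqueness of the maximisers the two sums agree term by term.\<close>

lemma inj_on_walk_point:
  assumes sk: "s < k"
  shows "inj_on (walk_point s) (walks k s n)"
proof (rule inj_onI)
  fix xs ys assume xs: "xs \<in> walks k s n" and ys: "ys \<in> walks k s n"
    and eq: "walk_point s xs = walk_point s ys"
  have len: "length xs = n" "length ys = n" using xs ys by (simp_all add: walks_def)
  obtain L :: "(nat \<Rightarrow> real) \<Rightarrow> real" where L: "linear L" and max: "\<forall>i<n. \<forall>y\<in>coord_simplex (window k s i).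
      y \<noteq> std_basis (s * i + xs ! i) \<longrightarrow> L y < L (std_basis (s * i + xs ! i))"
    using walk_functional[OF sk xs] by blast
  have "std_basis (s * i + ys ! i) = std_basis (s * i + xs ! i)" if "i < n" for i
  proof (rule sum_maximizer_unique[OF L, where I = "{..<n}"
        and S = "\<lambda>i. coord_simplex (window k s i)" and y = "\<lambda>i. std_basis (s * i + ys ! i)"
        and a = "\<lambda>i. std_basis (s * i + xs ! i)"])
    show "L (\<Sum>i<n. std_basis (s * i + xs ! i)) \<le> L (\<Sum>i<n. std_basis (s * i + ys ! i))"
      using eq by (simp add: walk_point_def len)
  qed (use max walk_nth_in_window[OF ys] std_basis_in_coord_simplex that in auto)
  then show "xs = ys"
    using len by (intro nth_equalityI) auto
qed

lemma extreme_point_is_walk_point: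
  assumes sk: "s < k" and ext: "v extreme_point_of P n k s"
  obtains xs where "xs \<in> walks k s n" "v = walk_point s xs"
proof -
  obtain y where v: "v = sum y {..<n}" and y: "\<And>i. i < n \<Longrightarrow> y i \<in> coord_simplex (window k s i)"
    using ext by (auto simp: extreme_point_of_def mem_P_iff)
  \<comment> \<open>Summands of an extreme point are extreme in their simplices, hence basis
    vectors.\<close>
  have "y i \<in> std_basis ` window k s i" if "i < n" for i
  proof -
    have "y i extreme_point_of coord_simplex (window k s i)"
      using ext y that unfolding v P_def by (intro extreme_point_of_sumD[of y "{..<n}"]) auto
    then show ?thesis
      unfolding coord_simplex_def by (rule extreme_point_of_convex_hull)
  qed
  then have "\<exists>q. i < n \<longrightarrow> q < k \<and> y i = std_basis (s * i + q)" for i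
    unfolding window_def using le_Suc_ex by fastforce
  then obtain p where p: "\<And>i. i < n \<Longrightarrow> p i < k" "\<And>i. i < n \<Longrightarrow> y i = std_basis (s * i + p i)"
    by metis
  have arc: "(p i, p (Suc i)) \<in> parcs (D k s)" if i: "Suc i < n" for i
  proof (rule ccontr)
    assume "(p i, p (Suc i)) \<notin> parcs (D k s)"
    then have forb: "s \<le> p i" "p (Suc i) < k - s" "p i \<noteq> s + p (Suc i)"
      using p(1)[of i] p(1)[of "Suc i"] i by (auto simp: arc_iff[OF sk])
    \<comment> \<open>By \<open>forb\<close> both basis vectors are available in both windows. Using
      the second twice moves \<open>v\<close> by \<open>d\<close>, using the first twice moves it by
      \<open>- d\<close>.\<close>
    define d where "d = y (Suc i) - y i"
    have both: "y j \<in> coord_simplex (window k s l)" if "j \<in> {i, Suc i}" "l \<in> {i, Suc i}" for j l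
    proof -
      have "s * j + p j \<in> window k s l"
        using that forb p(1)[of i] p(1)[of "Suc i"] i sk by (auto simp: in_window_iff)
      then show ?thesis using p(2)[of j] that i by (auto intro: std_basis_in_coord_simplex)
    qed
    have upd: "sum (y(j := y l)) {..<n} = v - y j + y l" if "j < n" for j l
    proof -
      have "sum (y(j := y l)) {..<n} = y l + sum y ({..<n} - {j})"
        using that by (subst sum.remove[of _ j]) auto
      also have "sum y ({..<n} - {j}) = v - y j"
        unfolding v using that by (subst sum_diff1) auto
      finally show ?thesis by (simp only: add.commute)
    qed
    have mem: "v - y j + y l \<in> P n k s" if "j \<in> {i, Suc i}" "l \<in> {i, Suc i}" for j l
      unfolding mem_P_iff
    proof (intro exI[of _ "y(j := y l)"] conjI allI impI)
      show "v - y j + y l = sum (y(j := y l)) {..<n}" using that i by (intro upd[symmetric]) auto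
    qed (use both that y in auto)
    have plus: "v - y i + y (Suc i) = v + d" and minus: "v - y (Suc i) + y i = v - d"
      by (simp_all add: d_def fun_eq_iff)
    have "v + d \<in> P n k s" "v - d \<in> P n k s"
      unfolding plus[symmetric] minus[symmetric] by (rule mem; simp)+
    then have "d = 0" using extreme_point_of_symmetric[OF ext] by blast
    then have "std_basis (s * Suc i + p (Suc i)) = std_basis (s * i + p i)"
      using p(2) i by (simp add: d_def)
    then show False using forb by simp
  qed
  show ?thesis
  proof
    show "map p [0..<n] \<in> walks k s n"
      using p(1) arc by (auto simp: walks_def successively_conv_nth)
    show "v = walk_point s (map p [0..<n])"
      unfolding v walk_point_def using p(2) by simp
  qed
qed

lemma vertex_count_eq_card_walks:
  assumes "s < k"
  shows "vertex_count k s n = card (walks k s n)"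
proof -
  have "{v. v extreme_point_of P n k s} = walk_point s ` walks k s n"
    using walk_point_extreme[OF assms] extreme_point_is_walk_point[OF assms] by blast
  then show ?thesis
    unfolding vertex_count_def by (simp add: card_image inj_on_walk_point[OF assms])
qed

section \<open>A positive eigenvector\<close>

text \<open>For \<open>p \<ge> s\<close> the eigenvector equation thus involves only the entry at
  \<open>p - s\<close> and the sum over the last \<open>s\<close> positions, while all
  \<open>p < s\<close> share one equation.\<close>

lemma out_arcs_eq:
  assumes "s < k" "p < k"
  shows "{q. (p, q) \<in> parcs (D k s)} = (if p < s then {..<k} else insert (p - s) {k - s..<k})"
proof (rule Set.set_eqI)
  fix q
  show "q \<in> {q. (p, q) \<in> parcs (D k s)} \<longleftrightarrow>
      q \<in> (if p < s then {..<k} else insert (p - s) {k - s..<k})"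
    unfolding mem_Collect_eq arc_iff[OF assms(1)] using assms by (cases "p < s") auto
qed

text \<open>
  In terms of \<open>\<mu> = 1 / \<rho>\<close> and with the entries at \<open>{k - s..<k}\<close> normalised to have sum 1, the
  eigenvector equations at \<open>p \<ge> s\<close> give \<open>v p = x * \<mu> ^ (p div s) + (\<Sum>t=1..p div s. \<mu> ^ t)\<close> with
  \<open>x = v 0\<close>. The normalisation determines \<open>x\<close>, and the equation at \<open>p < s\<close> becomes a polynomial
  equation in \<open>\<mu>\<close>.
\<close>
lemma positive_eigenvector:
  assumes s: "0 < s" and sk: "s < k"
  shows "\<exists>(\<rho>::real) v. \<rho> > 0 \<and> (\<forall>p. v p > 0) \<and>
    (\<forall>p<k. (\<Sum>q | (p, q) \<in> parcs (D k s). v q) = \<rho> * v p)"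
proof -
  \<comment> \<open>Here \<open>g\<close> is the part of \<open>v\<close> free of \<open>x\<close>.
    The last \<open>s\<close> entries sum to \<open>x * \<beta> \<mu> + \<alpha> \<mu>\<close>, all
    entries to \<open>x * \<gamma> \<mu> + \<delta> \<mu>\<close>.\<close>
  define g where "g \<mu> p = (\<Sum>t=1..p div s. \<mu> ^ t)" for \<mu> :: real and p
  define \<alpha> where "\<alpha> \<mu> = (\<Sum>p=k-s..<k. g \<mu> p)" for \<mu>
  define \<beta> where "\<beta> \<mu> = (\<Sum>p=k-s..<k. \<mu> ^ (p div s))" for \<mu> :: real
  define \<gamma> where "\<gamma> \<mu> = (\<Sum>p<k. \<mu> ^ (p div s))" for \<mu> :: real
  define \<delta> where "\<delta> \<mu> = (\<Sum>p<k. g \<mu> p)" for \<mu>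
  \<comment> \<open>Eliminating \<open>x\<close> from
    \<open>x * \<beta> \<mu> = 1 - \<alpha> \<mu>\<close> and
    \<open>x = \<mu> * (x * \<gamma> \<mu> + \<delta> \<mu>)\<close> leaves
    \<open>G \<mu> = 0\<close>.\<close>
  define G where "G \<mu> = (1 - \<alpha> \<mu>) * (1 - \<mu> * \<gamma> \<mu>) - \<mu> * \<beta> \<mu> * \<delta> \<mu>" for \<mu>
  note defs = g_def \<alpha>_def \<beta>_def \<gamma>_def \<delta>_def
  have last: "k - 1 \<in> {k-s..<k}" "1 \<in> {1..(k - 1) div s}"
    using s sk by (auto simp: Suc_le_eq div_greater_zero_iff)
  have g_nonneg: "g \<mu> p \<ge> 0" if "\<mu> \<ge> 0" for \<mu> p
    using that by (simp add: g_def sum_nonneg)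
  have g_last: "g \<mu> (k - 1) \<ge> \<mu>" if "\<mu> \<ge> 0" for \<mu>
    using member_le_sum[OF last(2), of "\<lambda>t. \<mu> ^ t"] that by (simp add: g_def)
  \<comment> \<open>Positivity of \<open>x\<close> needs \<open>\<alpha> \<mu> < 1\<close>, so the
    root of \<open>G\<close> is sought to the left of a point where \<open>\<alpha>\<close> equals
    1.\<close>
  have "\<alpha> 1 \<ge> 1"
    using member_le_sum[OF last(1), of "g 1"] g_last[of 1] g_nonneg[of 1] by (auto simp: \<alpha>_def)
  moreover have "\<alpha> 0 = 0" by (simp add: \<alpha>_def g_def power_0_left)
  moreover have "continuous_on {0..1} \<alpha>" unfolding defs by (intro continuous_intros)
  ultimately obtain \<mu>0 where \<mu>0: "0 \<le> \<mu>0" "\<mu>0 \<le> 1" "\<alpha> \<mu>0 = 1"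
    using IVT'[of \<alpha> 0 1 1] by auto
  have \<mu>0_pos: "\<mu>0 > 0" using \<mu>0 \<open>\<alpha> 0 = 0\<close> by (cases "\<mu>0 = 0") auto
  have \<beta>_pos: "\<beta> \<mu> > 0" if "\<mu> > 0" for \<mu>
    unfolding \<beta>_def using last(1) that by (intro sum_pos) auto
  have \<delta>_pos: "\<delta> \<mu> > 0" if "\<mu> > 0" for \<mu>
    using member_le_sum[of "k - 1" "{..<k}" "g \<mu>"] g_last[of \<mu>] g_nonneg[of \<mu>] that sk
    by (fastforce simp: \<delta>_def)
  \<comment> \<open>At \<open>\<mu>0\<close> the first product vanishes and the subtracted one is
    positive.\<close>
  have "G \<mu>0 \<le> 0"
    using \<mu>0 \<mu>0_pos \<beta>_pos[OF \<mu>0_pos] \<delta>_pos[OF \<mu>0_pos] by (simp add: G_def)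
  moreover have G0: "G 0 = 1" using \<open>\<alpha> 0 = 0\<close> by (simp add: G_def)
  moreover have "continuous_on {0..\<mu>0} G" unfolding G_def defs by (intro continuous_intros)
  ultimately obtain \<mu> where \<mu>: "0 \<le> \<mu>" "\<mu> \<le> \<mu>0" "G \<mu> = 0"
    using IVT2'[of G \<mu>0 0 0] \<mu>0 by auto
  have \<mu>_pos: "\<mu> > 0" using \<mu> G0 by (cases "\<mu> = 0") auto
  \<comment> \<open>Monotonicity bounds \<open>\<alpha> \<mu>\<close> by 1; equality would make
    \<open>G \<mu>\<close> negative.\<close>
  have "\<alpha> \<mu> \<le> \<alpha> \<mu>0"
    unfolding \<alpha>_def g_def using \<mu> by (intro sum_mono power_mono)
  moreover have "\<alpha> \<mu> \<noteq> 1"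
    using \<mu>(3) \<mu>_pos \<beta>_pos[OF \<mu>_pos] \<delta>_pos[OF \<mu>_pos] by (auto simp: G_def)
  ultimately have \<alpha>_less: "\<alpha> \<mu> < 1" using \<mu>0 by simp
  define x where "x = (1 - \<alpha> \<mu>) / \<beta> \<mu>"
  have x: "x > 0" using \<alpha>_less \<beta>_pos[OF \<mu>_pos] by (simp add: x_def)
  define v where "v p = x * \<mu> ^ (p div s) + g \<mu> p" for p
  have "x * \<beta> \<mu> = 1 - \<alpha> \<mu>" using \<beta>_pos[OF \<mu>_pos] by (simp add: x_def)
  then have T: "(\<Sum>q=k-s..<k. v q) = 1"
    by (simp add: v_def sum.distrib \<alpha>_def \<beta>_def flip: sum_distrib_left)
  have S: "(\<Sum>q<k. v q) = x * \<gamma> \<mu> + \<delta> \<mu>"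
    by (simp add: v_def sum.distrib \<gamma>_def \<delta>_def flip: sum_distrib_left)
  \<comment> \<open>Replacing \<open>1 - \<alpha> \<mu>\<close> by \<open>x * \<beta> \<mu>\<close>
    in \<open>G \<mu> = 0\<close> exposes the common factor \<open>\<beta> \<mu>\<close>; cancelling
    it leaves the equation at \<open>p < s\<close>.\<close>
  have "\<beta> \<mu> * x * (1 - \<mu> * \<gamma> \<mu>) = \<beta> \<mu> * (\<mu> * \<delta> \<mu>)"
    using \<mu>(3) \<open>x * \<beta> \<mu> = 1 - \<alpha> \<mu>\<close> by (simp add: G_def mult.commute mult.left_commute)
  then have "\<beta> \<mu> * x = \<beta> \<mu> * (\<mu> * (x * \<gamma> \<mu> + \<delta> \<mu>))"
    by (simp add: algebra_simps)
  then have x_eq: "x = \<mu> * (x * \<gamma> \<mu> + \<delta> \<mu>)"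
    using \<beta>_pos[OF \<mu>_pos] by (simp only: mult_cancel_left) simp
  have step: "v p = \<mu> * (v (p - s) + 1)" if "s \<le> p" for p
  proof -
    have div: "p div s = Suc ((p - s) div s)"
      using that s by (simp add: le_div_geq)
    have "(\<Sum>t=1..Suc m. \<mu> ^ t) = \<mu> * (\<Sum>t=1..m. \<mu> ^ t) + \<mu>" for m
    proof -
      have "(\<Sum>t=1..Suc m. \<mu> ^ t) = (\<Sum>t=0..m. \<mu> ^ Suc t)"
        by (simp only: One_nat_def sum.shift_bounds_cl_Suc_ivl)
      also have "\<dots> = \<mu> * (\<Sum>t=0..m. \<mu> ^ t)"
        by (simp add: sum_distrib_left)
      also have "(\<Sum>t=0..m. \<mu> ^ t) = 1 + (\<Sum>t=1..m. \<mu> ^ t)"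
        by (simp add: sum.atLeast_Suc_atMost)
      finally show ?thesis by (simp only: distrib_left mult_1_right add.commute)
    qed
    then show ?thesis
      unfolding v_def g_def div by (simp add: algebra_simps del: sum.cl_ivl_Suc)
  qed
  show ?thesis
  proof (intro exI conjI allI impI)
    show "1 / \<mu> > 0" using \<mu>_pos by simp
    show "v p > 0" for p
      unfolding v_def using x \<mu>_pos g_nonneg[of \<mu> p] by (intro add_pos_nonneg) auto
    show "(\<Sum>q | (p, q) \<in> parcs (D k s). v q) = 1 / \<mu> * v p" if "p < k" for p
    proof (cases "p < s")
      case True
      then have "v p = \<mu> * (x * \<gamma> \<mu> + \<delta> \<mu>)" using x_eq by (simp add: v_def g_def)
      then show ?thesis using True that sk \<mu>_pos by (simp add: out_arcs_eq S)
    next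
      case False
      then have "p - s \<notin> {k-s..<k}" using that by auto
      then show ?thesis
        using False that sk \<mu>_pos step[of p] T by (simp add: out_arcs_eq)
    qed
  qed
qed

section \<open>Maximality of an eigenvalue with a positive eigenvector\<close>

lemma finite_out_arcs [simp]: "finite {q. (p, q) \<in> parcs (D k s)}"
  by (rule finite_subset[of _ "{..<k}"]) (auto simp: D_def)

lemma A_mult_vec_nth:
  assumes "u \<in> carrier_vec k" "p < k"
  shows "(A k s *\<^sub>v u) $ p = (\<Sum>q | (p, q) \<in> parcs (D k s). u $ q)"
proof -
  have "(A k s *\<^sub>v u) $ p = (\<Sum>q\<in>{0..<k}. if (p, q) \<in> parcs (D k s) then u $ q else 0)"
    using assms by (auto simp: A_def scalar_prod_def intro!: sum.cong)
  also have "\<dots> = (\<Sum>q | q \<in> {0..<k} \<and> (p, q) \<in> parcs (D k s). u $ q)"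
    by (rule sum.inter_filter[symmetric]) simp
  also have "{q. q \<in> {0..<k} \<and> (p, q) \<in> parcs (D k s)} = {q. (p, q) \<in> parcs (D k s)}"
    by (auto simp: D_def)
  finally show ?thesis .
qed

text \<open>Given an eigenvector \<open>u\<close> for \<open>x > 0\<close>, choose \<open>p\<close>
  with the largest ratio of \<open>\<bar>u $ p\<bar>\<close> to \<open>v p\<close>. Then
  \<open>r p * v q\<close> bounds \<open>\<bar>u $ q\<bar>\<close>, with equality at
  \<open>p\<close>, and row \<open>p\<close> of the eigenvalue equation yields
  \<open>x \<le> \<rho>\<close>.\<close>

lemma lambda1_eq:
  assumes k: "0 < k" and \<rho>: "\<rho> > 0" and v: "\<And>p. v p > 0"
    and ev: "\<And>p. p < k \<Longrightarrow> (\<Sum>q | (p, q) \<in> parcs (D k s). v q) = \<rho> * v p"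
  shows "lambda1 k s = \<rho>"
  unfolding lambda1_def
proof (rule Max_eqI)
  have car: "A k s \<in> carrier_mat k k" by (simp add: A_def)
  have dim [simp]: "dim_row (A k s) = k" by (simp add: A_def)
  have "char_poly (A k s) \<noteq> 0"
    using degree_monic_char_poly[OF car] by (metis coeff_0 zero_neq_one)
  then have "finite {x. poly (char_poly (A k s)) x = 0}" by (rule poly_roots_finite)
  then show "finite {x. eigenvalue (A k s) x \<and> 0 < x}"
    by (rule rev_finite_subset) (auto simp: eigenvalue_root_char_poly[OF car])
  have "eigenvector (A k s) (vec k v) \<rho>"
    unfolding eigenvector_def
  proof (intro conjI)
    show "vec k v \<noteq> 0\<^sub>v (dim_row (A k s))"
      using v[of 0] k by (metis dim index_vec index_zero_vec(1) less_irrefl)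
    show "A k s *\<^sub>v vec k v = \<rho> \<cdot>\<^sub>v vec k v"
    proof (rule eq_vecI)
      fix p assume "p < dim_vec (\<rho> \<cdot>\<^sub>v vec k v)"
      then have p: "p < k" by simp
      have "(\<Sum>q | (p, q) \<in> parcs (D k s). vec k v $ q) = (\<Sum>q | (p, q) \<in> parcs (D k s). v q)"
        by (rule sum.cong) (auto simp: D_def)
      then show "(A k s *\<^sub>v vec k v) $ p = (\<rho> \<cdot>\<^sub>v vec k v) $ p"
        using p ev[OF p] A_mult_vec_nth[of "vec k v" k p s] by (simp del: index_mult_mat_vec)
    qed simp
  qed simp
  then show "\<rho> \<in> {x. eigenvalue (A k s) x \<and> 0 < x}"
    using \<rho> by (auto simp: eigenvalue_def)
  fix x assume "x \<in> {x. eigenvalue (A k s) x \<and> 0 < x}"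
  then obtain u where x: "x > 0" and u: "u \<in> carrier_vec k" "u \<noteq> 0\<^sub>v k" "A k s *\<^sub>v u = x \<cdot>\<^sub>v u"
    by (auto simp: eigenvalue_def eigenvector_def)
  define r where "r p = \<bar>u $ p\<bar> / v p" for p
  obtain p where p: "p < k" and r_max: "\<And>q. q < k \<Longrightarrow> r q \<le> r p"
  proof -
    have "Max (r ` {..<k}) \<in> r ` {..<k}" using k by (intro Max_in) auto
    then obtain p where "p < k" "r p = Max (r ` {..<k})" by auto
    then show ?thesis by (intro that[of p]) auto
  qed
  have bound: "\<bar>u $ q\<bar> \<le> r p * v q" if "q < k" for q
    using r_max[OF that] v[of q] by (simp add: r_def[of q] divide_le_eq)
  \<comment> \<open>Otherwise the maximal ratio would be 0 and \<open>u\<close> would vanish. This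
    allows \<open>\<bar>u $ p\<bar>\<close> to be cancelled at the end.\<close>
  have "u $ p \<noteq> 0"
  proof
    assume "u $ p = 0"
    then have "u $ q = 0" if "q < k" for q
      using bound[OF that] by (simp add: r_def)
    then have "u = 0\<^sub>v k" using u(1) by (intro eq_vecI) auto
    then show False using u(2) by simp
  qed
  have "x * \<bar>u $ p\<bar> = \<bar>(A k s *\<^sub>v u) $ p\<bar>"
    unfolding u(3) using x p carrier_vecD[OF u(1)] by (simp add: abs_mult)
  also have "\<dots> \<le> (\<Sum>q | (p, q) \<in> parcs (D k s). \<bar>u $ q\<bar>)"
    unfolding A_mult_vec_nth[OF u(1) p] by (rule sum_abs)
  also have "\<dots> \<le> (\<Sum>q | (p, q) \<in> parcs (D k s). r p * v q)"
    by (rule sum_mono) (auto simp: D_def intro!: bound)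
  also have "\<dots> = r p * (\<rho> * v p)"
    by (simp only: ev[OF p] flip: sum_distrib_left)
  also have "\<dots> = \<rho> * \<bar>u $ p\<bar>"
    using v[of p] by (simp add: r_def)
  finally show "x \<le> \<rho>" using \<open>u $ p \<noteq> 0\<close> by simp
qed

section \<open>Counting walks\<close>

lemma finite_walks: "finite (walks k s n)"
  by (rule finite_subset[OF _ finite_lists_length_eq[of "{..<k}" n]]) (auto simp: walks_def)

lemma card_walks_Suc:
  "card (walks k s (Suc n)) = (\<Sum>p<k. card {xs \<in> walks k s (Suc n). hd xs = p})"
proof -
  have "walks k s (Suc n) = (\<Union>p<k. {xs \<in> walks k s (Suc n). hd xs = p})"
    by (auto simp: walks_def length_Suc_conv)
  also have "card \<dots> = (\<Sum>p<k. card {xs \<in> walks k s (Suc n). hd xs = p})"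
    by (intro card_UN_disjoint) (auto simp: finite_walks)
  finally show ?thesis .
qed

text \<open>Walks arise by prepending \<open>p\<close> to a walk from an out-neighbour. Hence the
  vector of counts by first node is multiplied by \<open>A k s\<close> when walks get one node
  longer.\<close>

lemma card_walks_from_Suc:
  assumes "p < k"
  shows "card {xs \<in> walks k s (Suc (Suc n)). hd xs = p} =
    (\<Sum>q | (p, q) \<in> parcs (D k s). card {xs \<in> walks k s (Suc n). hd xs = q})"
proof -
  have "{xs \<in> walks k s (Suc (Suc n)). hd xs = p} =
      (\<Union>q\<in>{q. (p, q) \<in> parcs (D k s)}. (#) p ` {xs \<in> walks k s (Suc n). hd xs = q})"
    using assms by (fastforce simp: walks_def length_Suc_conv successively_Cons image_iff)
  also have "card \<dots> = (\<Sum>q | (p, q) \<in> parcs (D k s). card ((#) p ` {xs \<in> walks k s (Suc n). hd xs = q}))"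
    by (intro card_UN_disjoint) (auto simp: finite_walks)
  finally show ?thesis by (simp add: card_image)
qed

lemma walks_1_from: "p < k \<Longrightarrow> {xs \<in> walks k s (Suc 0). hd xs = p} = {[p]}"
  by (auto simp: walks_def length_Suc_conv)

text \<open>One-node walks give the all-ones vector, which lies between \<open>a\<close> and
  \<open>b\<close> times \<open>v\<close>. The recursion preserves such bounds and multiplies
  \<open>v\<close> by \<open>\<rho>\<close>.\<close>

lemma card_walks_from_bounds:
  fixes v :: "nat \<Rightarrow> real"
  assumes ev: "\<And>p. p < k \<Longrightarrow> (\<Sum>q | (p, q) \<in> parcs (D k s). v q) = \<rho> * v p"
    and bnd: "\<And>p. p < k \<Longrightarrow> a * v p \<le> 1" "\<And>p. p < k \<Longrightarrow> 1 \<le> b * v p"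
    and p: "p < k"
  shows "a * \<rho> ^ n * v p \<le> card {xs \<in> walks k s (Suc n). hd xs = p} \<and>
    card {xs \<in> walks k s (Suc n). hd xs = p} \<le> b * \<rho> ^ n * v p"
  using p
proof (induction n arbitrary: p)
  case 0
  then show ?case using bnd by (simp add: walks_1_from)
next
  case (Suc n)
  let ?N = "\<lambda>q. real (card {xs \<in> walks k s (Suc n). hd xs = q})"
  have eq: "c * \<rho> ^ Suc n * v p = (\<Sum>q | (p, q) \<in> parcs (D k s). c * \<rho> ^ n * v q)" for c
    unfolding sum_distrib_left[symmetric] ev[OF Suc.prems] by simp
  have out: "q < k" if "(p, q) \<in> parcs (D k s)" for q
    using that by (auto simp: D_def)
  have "(\<Sum>q | (p, q) \<in> parcs (D k s). a * \<rho> ^ n * v q) \<le> (\<Sum>q | (p, q) \<in> parcs (D k s). ?N q)"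
    "(\<Sum>q | (p, q) \<in> parcs (D k s). ?N q) \<le> (\<Sum>q | (p, q) \<in> parcs (D k s). b * \<rho> ^ n * v q)"
    using Suc.IH out by (auto intro!: sum_mono)
  then show ?case
    unfolding card_walks_from_Suc[OF Suc.prems] of_nat_sum eq by blast
qed

text \<open>After taking logarithms the constants contribute only \<open>ln a / real n\<close> and
  \<open>ln b / real n\<close>, which tend to 0.\<close>

lemma tendsto_ln_root_if_geometric_bounds:
  fixes f :: "nat \<Rightarrow> real"
  assumes pos: "\<rho> > 0" "a > 0" "b > 0"
    and f: "\<And>n. a * \<rho> ^ n \<le> f n" "\<And>n. f n \<le> b * \<rho> ^ n"
  shows "(\<lambda>n. 1 / real n * ln (f n)) \<longlonglongrightarrow> ln \<rho>"
proof (rule tendsto_sandwich)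
  have lim: "(\<lambda>n. ln c / real n + ln \<rho>) \<longlonglongrightarrow> ln \<rho>" for c
    using tendsto_add[OF lim_const_over_n[of "ln c"] tendsto_const[of "ln \<rho>"]] by simp
  show "(\<lambda>n. ln a / real n + ln \<rho>) \<longlonglongrightarrow> ln \<rho>" "(\<lambda>n. ln b / real n + ln \<rho>) \<longlonglongrightarrow> ln \<rho>"
    by (rule lim)+
  have eq: "ln c / real n + ln \<rho> = 1 / real n * ln (c * \<rho> ^ n)" if "c > 0" "n > 0" for c n
    using that pos by (simp add: ln_mult ln_realpow field_simps)
  have f_pos: "f n > 0" for n
    using f(1)[of n] pos by (meson less_le_trans mult_pos_pos zero_less_power)
  show "\<forall>\<^sub>F n in sequentially. ln a / real n + ln \<rho> \<le> 1 / real n * ln (f n)"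
    using eventually_gt_at_top[of 0] by eventually_elim (use pos f in \<open>auto simp: eq intro!: divide_right_mono ln_mono\<close>)
  show "\<forall>\<^sub>F n in sequentially. 1 / real n * ln (f n) \<le> ln b / real n + ln \<rho>"
    using eventually_gt_at_top[of 0]
    by eventually_elim (use pos f f_pos in \<open>auto simp: eq intro!: divide_right_mono ln_mono\<close>)
qed

theorem corollary4p17:
  fixes k s :: nat
  assumes "0 < s" and "s < k"
  shows "(\<lambda>n. 1 / real n * ln (real (vertex_count k s n))) \<longlonglongrightarrow> ln (lambda1 k s)"
proof -
  obtain \<rho> :: real and v where \<rho>: "\<rho> > 0" and v: "\<And>p. v p > 0"
    and "\<forall>p<k. (\<Sum>q | (p, q) \<in> parcs (D k s). v q) = \<rho> * v p"
    using positive_eigenvector[OF assms] by blast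
  then have ev: "(\<Sum>q | (p, q) \<in> parcs (D k s). v q) = \<rho> * v p" if "p < k" for p
    using that by blast
  have k: "0 < k" using assms by simp
  \<comment> \<open>Chosen so that \<open>a * v p \<le> 1\<close> and \<open>1 \<le> b * v p\<close>
    at every position \<open>p < k\<close>.\<close>
  define a b where "a = 1 / Max (v ` {..<k})" and "b = 1 / Min (v ` {..<k})"
  define S where "S = (\<Sum>p<k. v p)"
  have ne: "v ` {..<k} \<noteq> {}" using k by auto
  have pos: "Max (v ` {..<k}) > 0" "Min (v ` {..<k}) > 0" "S > 0"
    using v k ne by (auto simp: Max_gr_iff S_def intro!: sum_pos)
  have bnd: "a * v p \<le> 1" "1 \<le> b * v p" if "p < k" for p
    using that pos by (auto simp: a_def b_def divide_simps)
  have walk_bounds: "a * \<rho> ^ n * S \<le> card (walks k s (Suc n)) \<and> card (walks k s (Suc n)) \<le> b * \<rho> ^ n * S"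
    for n
    unfolding card_walks_Suc S_def sum_distrib_left of_nat_sum
    using card_walks_from_bounds[where v = v, OF ev bnd] by (auto intro!: sum_mono)
  have card0: "card (walks k s 0) = 1"
    by (simp add: walks_def conj_commute cong: conj_cong)
  have "(\<lambda>n. 1 / real n * ln (real (card (walks k s n)))) \<longlonglongrightarrow> ln \<rho>"
  proof (rule tendsto_ln_root_if_geometric_bounds[OF \<rho>])
    \<comment> \<open>Walks with \<open>Suc m\<close> nodes are counted by \<open>\<rho> ^ m\<close>
      up to constants, so division by \<open>\<rho>\<close> aligns the exponents. The 1 covers
      \<open>n = 0\<close>, where only the empty walk exists.\<close>
    show "min 1 (a * S / \<rho>) > 0" "max 1 (b * S / \<rho>) > 0"
      using pos \<rho> by (auto simp: a_def)
    fix n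
    show "min 1 (a * S / \<rho>) * \<rho> ^ n \<le> card (walks k s n)"
    proof (cases n)
      case (Suc m)
      have "min 1 (a * S / \<rho>) * \<rho> ^ n \<le> a * S / \<rho> * \<rho> ^ n"
        using \<rho> by (intro mult_right_mono) auto
      also have "\<dots> = a * \<rho> ^ m * S" using \<rho> by (simp add: Suc)
      finally show ?thesis using walk_bounds[of m] by (simp add: Suc)
    qed (simp add: card0)
    show "card (walks k s n) \<le> max 1 (b * S / \<rho>) * \<rho> ^ n"
    proof (cases n)
      case (Suc m)
      have "b * \<rho> ^ m * S = b * S / \<rho> * \<rho> ^ n" using \<rho> by (simp add: Suc)
      also have "\<dots> \<le> max 1 (b * S / \<rho>) * \<rho> ^ n"
        using \<rho> by (intro mult_right_mono) auto
      finally show ?thesis using walk_bounds[of m] by (simp add: Suc)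
    qed (simp add: card0)
  qed
  moreover have "lambda1 k s = \<rho>"
    by (rule lambda1_eq[where v = v]) (use k \<rho> v ev in auto)
  ultimately show ?thesis
    by (simp add: vertex_count_eq_card_walks[OF assms(2)])
qed

end
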